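(* Let $\mathcal{M}$ be a simple regular matroid of rank $r>0$ on $n$ elements and let $M\in\mathbb{Z}^{r\times n}$ be a full-rank weakly unimodular representation of $\mathcal{M}$. Then the facets of $\mathcal{P}_M$ are exactly the faces $F_{\mathbf{u}}$, for $\mathbf{u}\in\mathcal{P}_M^{\Delta}\cap\mathbb{Z}^r$, for which $M^T\mathbf{u}$ is a spanning $2$-cut of $M$.
   Context: A matrix $M\in\mathbb{Z}^{r\times n}$ with $0<r\le n$ is full-rank weakly unimodular if it has rank $r$ and every $r\times r$ minor lies in $\{0,\pm1\}$; it represents the matroid on $[n]$ whose independent sets are the sets of linearly independent columns. $\mathcal{P}_M\subseteq\mathbb{R}^r$ is the convex hull of the columns of $[M\mid -M]$, and $\mathcal{P}_M^{\Delta}=\{\mathbf{u}:\mathbf{u}\cdot\mathbf{x}\le1\ \forall\mathbf{x}\in\mathcal{P}_M\}$ is its polar. For $\mathbf{u}\in\mathcal{P}_M^{\Delta}\cap\mathbb{Z}^r$, $F_{\mathbf{u}}=\mathrm{conv}\{\mathbf{v}:\mathbf{v}\text{ a vertex of }\mathcal{P}_M,\ \mathbf{v}\cdot\mathbf{u}=1\}$. $\Gamma(M)=\mathrm{row}(M)\cap\mathbb{Z}^n$; a $2$-cut of $M$ is an element of $\Gamma(M)$ with entries in $\{0,\pm1\}$. A cut $\boldsymbol{\gamma}$ is spanning if its support $\{i:\gamma_i\ne0\}$ contains a basis of $\mathcal{M}$. *)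

theory Defs
  imports "HOL-Analysis.Analysis"
begin

text \<open>A matroid is given by its ground set \<open>E\<close> and its family \<open>\<I>\<close> of independent sets.\<close>

definition matroid :: "'e set \<Rightarrow> 'e set set \<Rightarrow> bool" where
  "matroid E \<I> \<longleftrightarrow>
     finite E \<and> \<I> \<subseteq> Pow E \<and> {} \<in> \<I> \<and>
     (\<forall>X\<in>\<I>. \<forall>Y\<subseteq>X. Y \<in> \<I>) \<and>
     (\<forall>X\<in>\<I>. \<forall>Y\<in>\<I>. card X < card Y \<longrightarrow> (\<exists>e\<in>Y - X. insert e X \<in> \<I>))"

definition matroid_basis :: "'e set set \<Rightarrow> 'e set \<Rightarrow> bool" where
  "matroid_basis \<I> B \<longleftrightarrow> B \<in> \<I> \<and> (\<forall>X\<in>\<I>. B \<subseteq> X \<longrightarrow> X = B)"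

definition matroid_rank :: "'e set set \<Rightarrow> nat" where
  "matroid_rank \<I> = Max (card ` \<I>)"

definition loop :: "'e set set \<Rightarrow> 'e \<Rightarrow> bool" where
  "loop \<I> e \<longleftrightarrow> {e} \<notin> \<I>"

definition parallel :: "'e set set \<Rightarrow> 'e \<Rightarrow> 'e \<Rightarrow> bool" where
  "parallel \<I> e f \<longleftrightarrow> e \<noteq> f \<and> \<not> loop \<I> e \<and> \<not> loop \<I> f \<and> {e, f} \<notin> \<I>"

definition simple_matroid :: "'e set \<Rightarrow> 'e set set \<Rightarrow> bool" where
  "simple_matroid E \<I> \<longleftrightarrow>
     matroid E \<I> \<and> (\<forall>e\<in>E. \<not> loop \<I> e) \<and> (\<forall>e\<in>E. \<forall>f\<in>E. \<not> parallel \<I> e f)"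

text \<open>
  Regularity means representability by a totally unimodular matrix with an arbitrary number \<open>m\<close>
  of rows.  As \<open>m\<close> is existentially quantified, the matrix is a function on
  \<open>{..<m} \<times> E\<close>; its minors are written with the Leibniz formula, rows and columns being selected
  by \<open>\<rho>\<close> and \<open>\<kappa>\<close>, and linear independence over the reals of the family of columns indexed by
  \<open>S\<close> is spelled out.
\<close>

definition minor :: "(nat \<Rightarrow> 'e \<Rightarrow> int) \<Rightarrow> nat \<Rightarrow> (nat \<Rightarrow> nat) \<Rightarrow> (nat \<Rightarrow> 'e) \<Rightarrow> int" where
  "minor A k \<rho> \<kappa> = (\<Sum>p | p permutes {..<k}. sign p * (\<Prod>i<k. A (\<rho> i) (\<kappa> (p i))))"

definition totally_unimodular :: "nat \<Rightarrow> 'e set \<Rightarrow> (nat \<Rightarrow> 'e \<Rightarrow> int) \<Rightarrow> bool" where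
  "totally_unimodular m E A \<longleftrightarrow>
     (\<forall>k \<rho> \<kappa>. inj_on \<rho> {..<k} \<and> \<rho> ` {..<k} \<subseteq> {..<m} \<and> inj_on \<kappa> {..<k} \<and> \<kappa> ` {..<k} \<subseteq> E
        \<longrightarrow> minor A k \<rho> \<kappa> \<in> {-1, 0, 1})"

definition regular_matroid :: "'e set \<Rightarrow> 'e set set \<Rightarrow> bool" where
  "regular_matroid E \<I> \<longleftrightarrow>
     matroid E \<I> \<and>
     (\<exists>m A. totally_unimodular m E A \<and>
        \<I> = {S. S \<subseteq> E \<and>
               (\<forall>c :: 'e \<Rightarrow> real. (\<forall>i<m. (\<Sum>j\<in>S. c j * of_int (A i j)) = 0)
                  \<longrightarrow> (\<forall>j\<in>S. c j = 0))})"

abbreviation real_matrix :: "int^'n^'r \<Rightarrow> real^'n^'r" where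
  "real_matrix M \<equiv> map_matrix real_of_int M"

text \<open>
  The injections from the row indices to the column indices select the maximal square submatrices
  (each of them once for every ordering of its columns, which only affects the sign of the minor).
\<close>

definition full_rank_weakly_unimodular :: "int^'n^'r \<Rightarrow> bool" where
  "full_rank_weakly_unimodular M \<longleftrightarrow>
     CARD('r) \<le> CARD('n) \<and> rank (real_matrix M) = CARD('r) \<and>
     (\<forall>\<kappa> :: 'r \<Rightarrow> 'n. inj \<kappa> \<longrightarrow> det (\<chi> i j. M $ i $ \<kappa> j) \<in> {-1, 0, 1})"

text \<open>
  Injectivity is needed because the columns form a family: equal columns are dependent.
\<close>

definition represents :: "int^'n^'r \<Rightarrow> 'n set set \<Rightarrow> bool" where
  "represents M \<I> \<longleftrightarrow>
     \<I> = {S. inj_on (\<lambda>j. column j (real_matrix M)) S \<and>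
             independent ((\<lambda>j. column j (real_matrix M)) ` S)}"

definition sym_polytope :: "int^'n^'r \<Rightarrow> (real^'r) set" where
  "sym_polytope M = convex hull (columns (real_matrix M) \<union> columns (- real_matrix M))"

definition polar :: "'a::real_inner set \<Rightarrow> 'a set" where
  "polar P = {u. \<forall>x\<in>P. u \<bullet> x \<le> 1}"

definition integer_points :: "(real^'k) set" where
  "integer_points = {x. \<forall>i. x $ i \<in> \<int>}"

definition face_at :: "int^'n^'r \<Rightarrow> real^'r \<Rightarrow> (real^'r) set" where
  "face_at M u = convex hull {v. v extreme_point_of sym_polytope M \<and> v \<bullet> u = 1}"

definition cut_lattice :: "int^'n^'r \<Rightarrow> (real^'n) set" where
  "cut_lattice M = span (rows (real_matrix M)) \<inter> integer_points"

definition two_cut :: "int^'n^'r \<Rightarrow> real^'n \<Rightarrow> bool" where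
  "two_cut M \<gamma> \<longleftrightarrow> \<gamma> \<in> cut_lattice M \<and> (\<forall>i. \<gamma> $ i \<in> {-1, 0, 1})"

definition spanning_cut :: "'n set set \<Rightarrow> real^'n \<Rightarrow> bool" where
  "spanning_cut \<I> \<gamma> \<longleftrightarrow> (\<exists>B. matroid_basis \<I> B \<and> B \<subseteq> {i. \<gamma> $ i \<noteq> 0})"

end

theory Submission
  imports Defs
begin

text \<open>
  Every facet has the form \<open>{x \<in> P. u \<bullet> x = 1}\<close> with \<open>u\<close> in the polar, because \<open>P\<close> is symmetric
  and full-dimensional; and such a face is a facet exactly when it linearly spans the whole space,
  that is, when the columns on which \<open>u\<close> takes the values \<open>\<plusminus>1\<close> contain a basis.  If they do,
  \<open>u\<close> solves an integral linear system of determinant \<open>\<plusminus>1\<close>, so it is integral by Cramer's rule,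
  and then the entries of \<open>M\<^sup>T u\<close>, being integers in \<open>[-1, 1]\<close>, form a 2-cut.
\<close>

section \<open>Affine dimension and unimodular linear systems\<close>

text \<open>The affine hull of \<open>S\<close> misses the origin, so adjoining 0 raises the affine
  dimension by exactly one and turns it into the linear dimension. This translates the codimension
  of a facet into a spanning condition.\<close>

lemma aff_dim_span_UNIV:
  fixes S :: "'a::euclidean_space set"
  assumes "\<And>x. x \<in> S \<Longrightarrow> u \<bullet> x = 1"
  shows "aff_dim S = int DIM('a) - 1 \<longleftrightarrow> span S = UNIV"
proof -
  have "affine hull S \<subseteq> {x. u \<bullet> x = 1}"
    by (rule hull_minimal) (use assms affine_hyperplane in auto)
  then have "0 \<notin> affine hull S" by auto
  then have "aff_dim (insert 0 S) = aff_dim S + 1"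
    by (simp add: aff_dim_insert)
  moreover have "aff_dim (insert 0 S) = int (dim S)"
    using aff_dim_zero [of "insert 0 S"] dim_span [of "insert 0 S"] by (simp add: hull_inc)
  ultimately show ?thesis unfolding dim_eq_full [symmetric] by linarith
qed

lemma det_in_Ints:
  fixes A :: "'a::comm_ring_1^'n^'n"
  assumes "\<And>i j. A $ i $ j \<in> \<int>"
  shows "det A \<in> \<int>"
  unfolding det_def using assms by (intro Ints_sum Ints_mult Ints_prod) auto

text \<open>By Cramer's rule each coordinate of \<open>x\<close> is an integral determinant divided
  by \<open>det A\<close>, and division by a unit of the integers preserves integrality.\<close>

lemma integer_solution_unimodular:
  fixes A :: "real^'n^'n"
  assumes A: "\<And>i j. A $ i $ j \<in> \<int>" and d: "det A \<in> {-1, 1}" and b: "\<And>i. (A *v x) $ i \<in> \<int>"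
  shows "x \<in> integer_points"
proof -
  let ?C = "\<lambda>k. (\<chi> i j. if j = k then (A *v x) $ i else A $ i $ j) :: real^'n^'n"
  have "det A \<noteq> 0" using d by auto
  then have "x = (\<chi> k. det (?C k) / det A)"
    using cramer [of A x "A *v x"] by simp
  from arg_cong [OF this, of "\<lambda>y. y $ k" for k]
  have "x $ k = det (?C k) / det A" for k by simp
  moreover have "det (?C k) \<in> \<int>" for k
    by (rule det_in_Ints) (use A b in simp)
  moreover have "1 / det A \<in> \<int>" using d by auto
  ultimately have "x $ k \<in> \<int>" for k
    using Ints_mult [of "det (?C k)" "1 / det A"] by simp
  then show ?thesis by (simp add: integer_points_def)
qed

lemma det_of_int:
  fixes A :: "int^'n^'n"
  shows "det (\<chi> i j. of_int (A $ i $ j)) = (of_int (det A) :: 'a::comm_ring_1)"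
  by (simp add: det_def)

section \<open>The symmetric polytope, its faces and its facets\<close>

context
  fixes M :: "int^'n^'r"
begin

private abbreviation "c \<equiv> \<lambda>j. column j (real_matrix M)"

lemma sym_polytope_altdef: "sym_polytope M = convex hull (range c \<union> uminus ` range c)"
proof -
  have "columns (- real_matrix M) = uminus ` range c"
    by (auto simp: columns_def column_def image_iff vec_eq_iff)
  moreover have "columns (real_matrix M) = range c"
    by (auto simp: columns_def)
  ultimately show ?thesis by (simp add: sym_polytope_def)
qed

lemma polytope_sym_polytope: "polytope (sym_polytope M)"
  unfolding sym_polytope_altdef by (intro polytope_convex_hull) auto

lemma column_in_sym_polytope: "c j \<in> sym_polytope M" "- c j \<in> sym_polytope M"
  unfolding sym_polytope_altdef by (auto intro!: hull_inc)

text \<open>Negation is linear and swaps the two halves of the generating set.\<close>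

lemma uminus_in_sym_polytope:
  assumes "x \<in> sym_polytope M"
  shows "- x \<in> sym_polytope M"
proof -
  have "uminus ` sym_polytope M = sym_polytope M"
    unfolding sym_polytope_altdef convex_hull_linear_image [OF linear_uminus]
    by (simp add: image_Un image_image Un_commute)
  then show ?thesis using assms by (metis image_eqI)
qed

lemma zero_in_sym_polytope: "0 \<in> sym_polytope M"
proof -
  \<comment> \<open>The index \<open>undefined\<close> stands for an arbitrary column; 0 is the
    midpoint of that column and its negative.\<close>
  have "(1/2) *\<^sub>R c undefined + (1/2) *\<^sub>R (- c undefined) \<in> sym_polytope M"
    using column_in_sym_polytope
    by (intro convexD polytope_imp_convex polytope_sym_polytope) auto
  then show ?thesis by simp
qed

lemma face_of_polar:
  assumes "u \<in> polar (sym_polytope M)"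
  shows "(sym_polytope M \<inter> {x. u \<bullet> x = 1}) face_of sym_polytope M"
  using assms polytope_imp_convex [OF polytope_sym_polytope]
  by (intro face_of_Int_supporting_hyperplane_le) (auto simp: polar_def)

text \<open>The exposed face on the right is a polytope, hence the hull of its extreme points, and
  these are the extreme points of the whole polytope that lie in it.\<close>

lemma face_at_polar:
  assumes "u \<in> polar (sym_polytope M)"
  shows "face_at M u = sym_polytope M \<inter> {x. u \<bullet> x = 1}" (is "_ = ?G")
proof -
  have "polytope ?G"
    by (rule face_of_polytope_polytope [OF polytope_sym_polytope face_of_polar [OF assms]])
  then have "?G = convex hull {x. x extreme_point_of ?G}"
    by (intro Krein_Milman_Minkowski polytope_imp_compact polytope_imp_convex)
  also have "{x. x extreme_point_of ?G} = {x. x extreme_point_of sym_polytope M \<and> x \<bullet> u = 1}"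
    using extreme_point_of_face [OF face_of_polar [OF assms]]
    by (auto simp: extreme_point_of_def inner_commute)
  finally show ?thesis by (simp add: face_at_def)
qed

text \<open>Every extreme point is a column up to sign, and signs do not affect spans. Conversely, a
  column on which \<open>u\<close> takes the value 1 or -1 lies in the face, up to sign, whether or
  not it is a vertex.\<close>

lemma span_face_at:
  assumes "u \<in> polar (sym_polytope M)"
  shows "span (face_at M u) = span (c ` {j. u \<bullet> c j \<in> {-1, 1}})" (is "_ = span (c ` ?J)")
proof
  have "v \<in> span (c ` ?J)" if v: "v extreme_point_of sym_polytope M" "v \<bullet> u = 1" for v
  proof -
    have "v \<in> range c \<union> uminus ` range c"
      using v(1) extreme_point_of_convex_hull unfolding sym_polytope_altdef by blast
    then show ?thesis using v(2)
      by (auto simp: inner_commute intro!: span_neg intro: span_base)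
  qed
  then have "face_at M u \<subseteq> span (c ` ?J)"
    unfolding face_at_def by (intro hull_minimal subspace_imp_convex) auto
  then show "span (face_at M u) \<subseteq> span (c ` ?J)"
    by (simp add: span_minimal)
next
  have "c j \<in> span (face_at M u)" if "j \<in> ?J" for j
  proof (cases "u \<bullet> c j = 1")
    case True
    then show ?thesis
      using column_in_sym_polytope by (auto simp: face_at_polar [OF assms] intro: span_base)
  next
    case False
    then have "- c j \<in> span (face_at M u)"
      using that column_in_sym_polytope
      by (auto simp: face_at_polar [OF assms] intro: span_base)
    then show ?thesis using span_neg by fastforce
  qed
  then show "span (c ` ?J) \<subseteq> span (face_at M u)"
    by (intro span_minimal) auto
qed

lemma aff_dim_sym_polytope:
  assumes "span (range c) = UNIV"
  shows "aff_dim (sym_polytope M) = CARD('r)"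
proof -
  have "range c \<subseteq> sym_polytope M" using column_in_sym_polytope by auto
  then have "span (sym_polytope M) = UNIV" using span_mono assms by blast
  then have "dim (sym_polytope M) = CARD('r)" using dim_eq_full by force
  then show ?thesis using zero_in_sym_polytope by (simp add: aff_dim_zero hull_inc)
qed

text \<open>This is the real version of the theorem, before integrality enters. The polytope is
  full-dimensional, so a face on which \<open>u\<close> equals 1 is a facet iff it spans the space
  linearly.\<close>

lemma facet_of_sym_polytope_iff:
  assumes span: "span (range c) = UNIV"
  shows "F facet_of sym_polytope M \<longleftrightarrow>
    (\<exists>u \<in> polar (sym_polytope M). F = face_at M u \<and> span (c ` {j. u \<bullet> c j \<in> {-1, 1}}) = UNIV)"
proof
  assume F: "F facet_of sym_polytope M"
  then have "F exposed_face_of sym_polytope M"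
    using exposed_face_of_polyhedron facet_of_imp_face_of
      polytope_imp_polyhedron [OF polytope_sym_polytope] by blast
  then obtain a b where ab: "sym_polytope M \<subseteq> {x. a \<bullet> x \<le> b}"
      "F = sym_polytope M \<inter> {x. a \<bullet> x = b}"
    by (auto simp: exposed_face_of_def)
  \<comment> \<open>If \<open>b\<close> were 0, symmetry would make \<open>a\<close> vanish on the
    whole polytope, and the face would not be proper.\<close>
  have "b \<noteq> 0"
  proof
    assume "b = 0"
    have "a \<bullet> x = 0" if "x \<in> sym_polytope M" for x
    proof -
      have "a \<bullet> x \<le> 0" "a \<bullet> (- x) \<le> 0"
        using ab(1) that uminus_in_sym_polytope [OF that] \<open>b = 0\<close> by blast+
      then show ?thesis by simp
    qed
    then have "F = sym_polytope M" using ab(2) \<open>b = 0\<close> by auto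
    with F show False by (simp add: facet_of_def)
  qed
  moreover have "b \<ge> 0" using ab(1) zero_in_sym_polytope by force
  ultimately have "b > 0" by simp
  \<comment> \<open>Dividing by the positive \<open>b\<close> normalises the supporting inequality,
    which puts the normal vector into the polar.\<close>
  define u where "u = a /\<^sub>R b"
  have ub: "u \<bullet> x = a \<bullet> x / b" for x by (simp add: u_def field_simps)
  have u: "u \<in> polar (sym_polytope M)"
    using ab(1) \<open>b > 0\<close> by (auto simp: polar_def ub)
  have Fu: "F = face_at M u"
    using ab(2) \<open>b > 0\<close> by (auto simp: face_at_polar [OF u] ub)
  have "aff_dim F = int DIM(real^'r) - 1"
    using F aff_dim_sym_polytope [OF span] by (simp add: facet_of_def)
  then have "span F = UNIV"
    by (subst (asm) aff_dim_span_UNIV) (auto simp: Fu face_at_polar [OF u])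
  then show "\<exists>u \<in> polar (sym_polytope M). F = face_at M u \<and> span (c ` {j. u \<bullet> c j \<in> {-1, 1}}) = UNIV"
    using u Fu span_face_at by metis
next
  assume "\<exists>u \<in> polar (sym_polytope M). F = face_at M u \<and> span (c ` {j. u \<bullet> c j \<in> {-1, 1}}) = UNIV"
  then obtain u where u: "u \<in> polar (sym_polytope M)" and Fu: "F = face_at M u"
    and "span F = UNIV"
    using span_face_at by metis
  then have dim: "aff_dim F = int DIM(real^'r) - 1"
    by (subst aff_dim_span_UNIV) (auto simp: face_at_polar)
  \<comment> \<open>The empty set has affine dimension -1, whereas \<open>CARD('r) - 1\<close> is
    nonnegative.\<close>
  moreover have "F \<noteq> {}"
  proof
    assume "F = {}"
    with dim show False by simp
  qed
  ultimately show "F facet_of sym_polytope M"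
    using face_of_polar [OF u] aff_dim_sym_polytope [OF span]
    by (simp add: facet_of_def Fu face_at_polar [OF u])
qed

section \<open>Integrality, 2-cuts and bases of the matroid\<close>

lemma span_columns_full_rank:
  assumes "full_rank_weakly_unimodular M"
  shows "span (range c) = UNIV"
proof -
  have "columns (real_matrix M) = range c" by (auto simp: columns_def)
  then have "dim (range c) = CARD('r)"
    using assms by (metis column_rank_def full_rank_weakly_unimodular_def)
  then show ?thesis using dim_eq_full by force
qed

lemma transpose_mult_eq_inner: "(transpose (real_matrix M) *v u) $ j = u \<bullet> c j"
  by (simp add: matrix_vector_mult_def transpose_def column_def inner_vec_def mult.commute)

text \<open>Equal columns may share a point of \<open>c ` J\<close>, hence the choice of a set of indices.\<close>

lemma spanning_imp_basis_indices:
  assumes "span (c ` J) = UNIV"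
  obtains B where "B \<subseteq> J" "inj_on c B" "independent (c ` B)" "span (c ` B) = UNIV"
    "card B = CARD('r)"
proof -
  obtain b where b: "b \<subseteq> c ` J" "independent b" "span b = UNIV"
    using maximal_independent_subset [of "c ` J"] assms
    by (metis span_minimal subspace_span top.extremum_uniqueI)
  then have "card b = CARD('r)"
    using dim_eq_card [of b UNIV] by simp
  moreover obtain B where "B \<subseteq> J" "inj_on c B" "b = c ` B"
    using b(1) by (auto simp: subset_image_inj)
  ultimately show thesis using b that by (metis card_image)
qed

text \<open>A basis of columns on which \<open>u\<close> takes the values 1 and -1 gives a square
  system for \<open>u\<close> with integral right-hand side. Its determinant is a nonzero maximal
  minor, hence 1 or -1.\<close>

lemma integral_if_spanning:
  assumes M: "full_rank_weakly_unimodular M"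
    and span: "span (c ` {j. u \<bullet> c j \<in> {-1, 1}}) = UNIV"
  shows "u \<in> integer_points"
proof -
  obtain B where B: "B \<subseteq> {j. u \<bullet> c j \<in> {-1, 1}}" "span (c ` B) = UNIV" "card B = CARD('r)"
    using spanning_imp_basis_indices [OF span] by metis
  obtain \<kappa> :: "'r \<Rightarrow> 'n" where \<kappa>: "bij_betw \<kappa> UNIV B"
    using B(3) finite_same_card_bij [of "UNIV :: 'r set" B] by auto
  \<comment> \<open>The chosen columns become rows here, so that \<open>A *v u\<close> lists the
    values of \<open>u\<close> on them; transposing does not change the determinant.\<close>
  define A :: "real^'r^'r" where "A = (\<chi> i j. real_of_int (M $ j $ \<kappa> i))"
  have row: "row i A = c (\<kappa> i)" for i
    by (simp add: A_def row_def column_def vec_eq_iff)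
  have "rows A = c ` B"
    using \<kappa> by (auto simp: rows_def row bij_betw_def)
  then have "det A \<noteq> 0"
    using B(2) invertible_det_nz invertible_left_inverse matrix_left_invertible_span_rows by metis
  moreover have "det A = of_int (det (\<chi> i j. M $ i $ \<kappa> j))"
  proof -
    have "A = transpose (\<chi> i j. of_int ((\<chi> i j. M $ i $ \<kappa> j) $ i $ j))"
      by (simp add: A_def transpose_def)
    then show ?thesis by (simp only: det_transpose det_of_int)
  qed
  moreover have "det (\<chi> i j. M $ i $ \<kappa> j) \<in> {-1, 0, 1}"
    using M \<kappa> by (auto simp: full_rank_weakly_unimodular_def bij_betw_def)
  ultimately have "det A \<in> {-1, 1}" by auto
  moreover have "(A *v u) $ i \<in> \<int>" for i
  proof -
    have "(A *v u) $ i = u \<bullet> c (\<kappa> i)"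
      by (simp add: matrix_vector_mult_def A_def column_def inner_vec_def mult.commute)
    moreover have "\<kappa> i \<in> B" using \<kappa> by (auto simp: bij_betw_def)
    ultimately show ?thesis using B(1) by auto
  qed
  ultimately show ?thesis
    by (intro integer_solution_unimodular [of A]) (auto simp: A_def)
qed

text \<open>The polar inequality at a column and at its negative bounds each entry by 1 in absolute
  value, and an integral \<open>u\<close> makes the entry an integer.\<close>

lemma two_cut_if_integral:
  assumes "u \<in> polar (sym_polytope M)" "u \<in> integer_points"
  shows "two_cut M (transpose (real_matrix M) *v u)"
proof -
  have int: "u \<bullet> c j \<in> \<int>" for j
    using assms(2) by (auto simp: inner_vec_def column_def integer_points_def intro!: Ints_sum Ints_mult)
  have "\<bar>u \<bullet> c j\<bar> \<le> 1" for j
    using assms(1) column_in_sym_polytope [of j] by (auto simp: polar_def abs_le_iff)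
  moreover have "x \<in> {-1, 0, 1}" if "x \<in> \<int>" "\<bar>x\<bar> \<le> 1" for x :: real
    using that by (auto elim!: Ints_cases)
  ultimately have "u \<bullet> c j \<in> {-1, 0, 1}" for j
    using int by blast
  moreover have "transpose (real_matrix M) *v u \<in> span (rows (real_matrix M))"
    by (metis columns_transpose matrix_vector_mult_in_columnspace)
  ultimately show ?thesis
    using int unfolding two_cut_def cut_lattice_def integer_points_def
    by (simp add: transpose_mult_eq_inner del: transpose_matrix_vector)
qed

text \<open>A maximal independent set of columns spans, because a column outside its span could be
  added. Conversely, \<open>CARD('r)\<close> independent columns are maximal by dimension.\<close>

lemma spanning_cut_iff:
  assumes rep: "represents M \<I>" and full: "span (range c) = UNIV"
  shows "spanning_cut \<I> \<gamma> \<longleftrightarrow> span (c ` {j. \<gamma> $ j \<noteq> 0}) = UNIV"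
proof
  assume "spanning_cut \<I> \<gamma>"
  then obtain B where B: "matroid_basis \<I> B" "B \<subseteq> {j. \<gamma> $ j \<noteq> 0}"
    by (auto simp: spanning_cut_def)
  have ind: "inj_on c B" "independent (c ` B)"
    using B(1) rep by (auto simp: matroid_basis_def represents_def)
  have "c j \<in> span (c ` B)" for j
  proof (rule ccontr)
    assume j: "c j \<notin> span (c ` B)"
    \<comment> \<open>This keeps \<open>c\<close> injective on \<open>insert j B\<close>, as
      independence in the matroid is about indices and not just about the set of columns.\<close>
    have "c j \<notin> c ` B"
    proof
      assume "c j \<in> c ` B"
      with j show False by (metis span_base)
    qed
    moreover have "independent (insert (c j) (c ` B))"
      by (rule independent_insertI [OF j ind(2)])
    ultimately have "insert j B \<in> \<I>"
      using ind(1) unfolding rep [unfolded represents_def] by auto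
    then have "insert j B = B" using B(1) by (auto simp: matroid_basis_def)
    then show False using \<open>c j \<notin> c ` B\<close> by blast
  qed
  then have "span (range c) \<subseteq> span (c ` B)"
    by (intro span_minimal) auto
  then show "span (c ` {j. \<gamma> $ j \<noteq> 0}) = UNIV"
    using full span_mono [OF image_mono [OF B(2), of c]] by auto
next
  assume "span (c ` {j. \<gamma> $ j \<noteq> 0}) = UNIV"
  then obtain B where B: "B \<subseteq> {j. \<gamma> $ j \<noteq> 0}" "inj_on c B" "independent (c ` B)"
      "card B = CARD('r)"
    using spanning_imp_basis_indices by metis
  have "X = B" if X: "X \<in> \<I>" "B \<subseteq> X" for X
  proof -
    have "card X = card (c ` X)" "independent (c ` X)"
      using X(1) rep by (auto simp: represents_def card_image)
    then have "card X \<le> card B"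
      using independent_bound [of "c ` X"] B(4) by simp
    then show ?thesis using X(2) card_seteq [of X B] by simp
  qed
  moreover have "B \<in> \<I>" using B rep by (simp add: represents_def)
  ultimately show "spanning_cut \<I> \<gamma>"
    using B(1) by (auto simp: spanning_cut_def matroid_basis_def)
qed

end

theorem theorem5p8:
  fixes M :: "int^'n^'r" and \<I> :: "'n set set"
  assumes "simple_matroid UNIV \<I>"
    and "regular_matroid UNIV \<I>"
    and "matroid_rank \<I> = CARD('r)"
    and "full_rank_weakly_unimodular M"
    and "represents M \<I>"
  shows "{F. F facet_of sym_polytope M} =
         {face_at M u | u. u \<in> polar (sym_polytope M) \<inter> integer_points \<and>
            two_cut M (transpose (real_matrix M) *v u) \<and>
            spanning_cut \<I> (transpose (real_matrix M) *v u)}"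
proof -
  let ?J = "\<lambda>u. {j. u \<bullet> column j (real_matrix M) \<in> {-1, 1}}"
  let ?spanning = "\<lambda>u. span ((\<lambda>j. column j (real_matrix M)) ` ?J u) = UNIV"
  note full = span_columns_full_rank [OF assms(4)]
  \<comment> \<open>For a 2-cut, a nonzero entry is 1 or -1, so the support is exactly the index set
    \<open>?J u\<close> of the facet criterion.\<close>
  have "spanning_cut \<I> (transpose (real_matrix M) *v u) \<longleftrightarrow> ?spanning u"
    if "two_cut M (transpose (real_matrix M) *v u)" for u
  proof -
    have "u \<bullet> column j (real_matrix M) \<in> {-1, 0, 1}" for j
      using that unfolding two_cut_def transpose_mult_eq_inner by blast
    then have "{j. (transpose (real_matrix M) *v u) $ j \<noteq> 0} = ?J u"
      unfolding transpose_mult_eq_inner by force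
    then show ?thesis
      using spanning_cut_iff [OF assms(5) full, of "transpose (real_matrix M) *v u"] by simp
  qed
  \<comment> \<open>For \<open>u\<close> in the polar, spanning forces integrality, which in turn
    yields the 2-cut property; so the conditions collapse to those of the facet criterion.\<close>
  then have "u \<in> polar (sym_polytope M) \<inter> integer_points \<and>
        two_cut M (transpose (real_matrix M) *v u) \<and>
        spanning_cut \<I> (transpose (real_matrix M) *v u) \<longleftrightarrow>
      u \<in> polar (sym_polytope M) \<and> ?spanning u" for u
    using integral_if_spanning [OF assms(4)] two_cut_if_integral by blast
  then show ?thesis
    using facet_of_sym_polytope_iff [OF full] by auto
qed

end
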